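(* Let $\boldsymbol{x}(t)\in\mathbb{R}^n$ be the solution of the stochastic differential equation $d\boldsymbol{x}=\boldsymbol{f}(\boldsymbol{x},t)\,dt+\boldsymbol{g}(\boldsymbol{x},t)\,d\boldsymbol{w}_t$. Let $\boldsymbol{\mu}=[\mu_{\boldsymbol{m}_1},\dots,\mu_{\boldsymbol{m}_k}]^\top$ be the vector of all moments of $\boldsymbol{x}$ of orders $1,\dots,M$, and let $\overline{\boldsymbol{\mu}}\in\mathbb{R}^r$ be the vector of moments of order at least $M+1$ appearing in the (unclosed) moment dynamics $$\frac{d\boldsymbol{\mu}}{dt}=\boldsymbol{a}+\boldsymbol{A}\boldsymbol{\mu}+\boldsymbol{B}\overline{\boldsymbol{\mu}} .$$ For each element $\mu_{\overline{\boldsymbol{m}}}$ of $\overline{\boldsymbol{\mu}}$, assume that the corresponding entry $\phi_{\overline{\boldsymbol{m}}}$ of the moment closure function $\overline{\boldsymbol{\varphi}}$ is chosen as $$\phi_{\overline{\boldsymbol{m}}}(\boldsymbol{\mu})=\prod_{p=1}^{k}\left(\mu_{\boldsymbol{m}_p}\right)^{\alpha_p},$$ where the coefficients $\alpha_1,\dots,\alpha_k$ (depending on $\overline{\boldsymbol{m}}$) are the unique solution of the system of linear equations $$\boldsymbol{C}^{\overline{\boldsymbol{m}}}_{\boldsymbol{m}_s}=\sum_{p=1}^{k}\alpha_p\,\boldsymbol{C}^{\boldsymbol{m}_p}_{\boldsymbol{m}_s},\qquad s=1,2,\dots,k .$$ Let $\boldsymbol{\nu}(t)\in\mathbb{R}^k$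 be the solution of the closed system $$\frac{d\boldsymbol{\nu}}{dt}=\boldsymbol{a}+\boldsymbol{A}\boldsymbol{\nu}+\boldsymbol{B}\,\overline{\boldsymbol{\varphi}}(\boldsymbol{\nu}).$$ Then, for every deterministic initial condition $\boldsymbol{x}(t_0)=\boldsymbol{x}_0\in\mathbb{R}^n$, if $\boldsymbol{\mu}(t_0)=\boldsymbol{\nu}(t_0)$, then $$\frac{d\boldsymbol{\mu}(t)}{dt}\Bigg|_{t=t_0}=\frac{d\boldsymbol{\nu}(t)}{dt}\Bigg|_{t=t_0}\qquad\text{and}\qquad \frac{d^2\boldsymbol{\mu}(t)}{dt^2}\Bigg|_{t=t_0}=\frac{d^2\boldsymbol{\nu}(t)}{dt^2}\Bigg|_{t=t_0}.$$
   Context: **SDE.** $\boldsymbol{x}=[x_1,\dots,x_n]^\top\in\mathbb{R}^n$; the drift is $\boldsymbol{f}:\mathbb{R}^n\times[0,\infty)\to\mathbb{R}^n$; the diffusion coefficient $\boldsymbol{g}$ takes values in $\mathbb{R}^{n\times n}$; $\boldsymbol{w}_t$ is an $n$-dimensional Wiener process with $\langle d\boldsymbol{w}_t\rangle=\boldsymbol{0}$, $\langle d\boldsymbol{w}_t\,d\boldsymbol{w}_t^\top\rangle=\boldsymbol{I}\,dt$. Here $\langle\cdot\rangle$ denotes expectation. It is assumed throughout that sufficient mathematical requirements for existence of the solution of the SDE hold. The initial condition $\boldsymbol{x}(t_0)=\boldsymbol{x}_0$ is deterministic, i.e. it holds with probability one; $t_0\in[0,\infty)$. **Moments.** For $\boldsymbol{m}=[m_1,\dots,m_n]^\top\in\mathbb{Z}_{\ge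 0}^n$ write $\boldsymbol{x}^{[\boldsymbol{m}]}=x_1^{m_1}x_2^{m_2}\cdots x_n^{m_n}$ and $\mu_{\boldsymbol{m}}=\langle\boldsymbol{x}^{[\boldsymbol{m}]}\rangle$; the order of this moment is $\sum_{j=1}^n m_j$. The moments evolve according to $$\frac{d\mu_{\boldsymbol{m}}}{dt}=\sum_{i=1}^{n}\left\langle f_i\frac{\partial\boldsymbol{x}^{[\boldsymbol{m}]}}{\partial x_i}\right\rangle+\frac12\sum_{i=1}^{n}\sum_{j=1}^{n}\left\langle(\boldsymbol{g}\boldsymbol{g}^\top)_{ij}\frac{\partial^2\boldsymbol{x}^{[\boldsymbol{m}]}}{\partial x_i\partial x_j}\right\rangle .$$ **Moment dynamics.** $M$ is the order of truncation. The vector $\boldsymbol{\mu}=[\mu_{\boldsymbol{m}_1},\dots,\mu_{\boldsymbol{m}_k}]^\top$ collects all moments of orders $1$ through $M$, so $k=\frac{(M+n)!}{M!\,n!}-1$. Its entries are stacked in graded lexicographical order: the first $n$ entries are the moments of first order, the next $n(n+1)/2$ entries are the moments of second order, and so on. When $\boldsymbol{f}(\boldsymbol{x},t)$ and $\boldsymbol{g}(\boldsymbol{x},t)$ are polynomials in $\boldsymbol{x}$, the evolution equations for the entries of $\boldsymbol{\mu}$ take the form $\frac{d\boldsymbol{\mu}}{dt}=\boldsymbol{a}+\boldsymbol{A}\boldsymbol{\mu}+\boldsymbol{B}\overline{\boldsymbol{\mu}}$, where $\boldsymbol{a},\boldsymbol{A},\boldsymbol{B}$ are determined by $\boldsymbol{f}$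 and $\boldsymbol{g}$ and $\overline{\boldsymbol{\mu}}\in\mathbb{R}^r$ is a vector of moments $\mu_{\overline{\boldsymbol{m}}}$, $\overline{\boldsymbol{m}}\in\mathbb{Z}_{\ge0}^n$, of order greater than or equal to $M+1$. **Moment closure.** A moment closure function is a map $\overline{\boldsymbol{\varphi}}$ from $\mathbb{R}^k$ to $\mathbb{R}^r$ whose entry corresponding to the element $\mu_{\overline{\boldsymbol{m}}}$ of $\overline{\boldsymbol{\mu}}$ is denoted $\phi_{\overline{\boldsymbol{m}}}$ and is meant as an approximation of $\mu_{\overline{\boldsymbol{m}}}$ in terms of the entries of $\boldsymbol{\mu}$. The vector $\boldsymbol{\nu}=[\nu_{\boldsymbol{m}_1},\dots,\nu_{\boldsymbol{m}_k}]^\top$ is the state of the system obtained by replacing $\overline{\boldsymbol{\mu}}$ by $\overline{\boldsymbol{\varphi}}(\boldsymbol{\nu})$. **Binomial notation.** For $\hat{\boldsymbol{m}},\breve{\boldsymbol{m}}\in\mathbb{Z}_{\ge0}^n$, $$\boldsymbol{C}^{\hat{\boldsymbol{m}}}_{\breve{\boldsymbol{m}}}=C^{\hat m_1}_{\breve m_1}C^{\hat m_2}_{\breve m_2}\cdots C^{\hat m_n}_{\breve m_n},\qquad C^{h}_{l}=\begin{cases}\dfrac{h!}{l!\,(h-l)!}, & h\ge l,\\[1ex] 0,& h<l.\end{cases}$$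
   Formalization: The formal theorem assumes M ≥ 2 (the claim fails for M = 1), that f and g are differentiable in t at t0 (otherwise the second derivatives may not exist), and that ν stays where the powers in the closure functions that occur are defined; derivatives at t0 are one-sided. *)

theory Defs
  imports "HOL-Probability.Probability"
begin

section \<open>Multi-indices and moments\<close>

text \<open>A multi-index with \<open>n = CARD('n)\<close> entries is an element of \<open>nat ^ 'n\<close>.\<close>

definition mpow :: "real ^ 'n \<Rightarrow> nat ^ 'n \<Rightarrow> real"
  where "mpow x q = (\<Prod>i\<in>UNIV. (x $ i) ^ (q $ i))"

definition mdeg :: "nat ^ 'n \<Rightarrow> nat"
  where "mdeg q = (\<Sum>i\<in>UNIV. q $ i)"

definition mchoose :: "nat ^ 'n \<Rightarrow> nat ^ 'n \<Rightarrow> nat"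
  where "mchoose h l = (\<Prod>i\<in>UNIV. (h $ i) choose (l $ i))"

definition moment :: "'a measure \<Rightarrow> (real \<Rightarrow> 'a \<Rightarrow> real ^ 'n) \<Rightarrow> nat ^ 'n \<Rightarrow> real \<Rightarrow> real"
  where "moment P X q t = (\<integral>\<omega>. mpow (X t \<omega>) q \<partial>P)"

definition moment_vec ::
    "'a measure \<Rightarrow> (real \<Rightarrow> 'a \<Rightarrow> real ^ 'n) \<Rightarrow> ('k \<Rightarrow> nat ^ 'n) \<Rightarrow> real \<Rightarrow> real ^ 'k"
  where "moment_vec P X m t = (\<chi> p. moment P X (m p) t)"


section \<open>Stochastic differential equations\<close>

definition wiener_process ::
    "'a measure \<Rightarrow> (real \<Rightarrow> 'a measure) \<Rightarrow> (real \<Rightarrow> 'a \<Rightarrow> real ^ 'n) \<Rightarrow> bool"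
  where "wiener_process P F W \<longleftrightarrow>
    filtration (space P) F \<and> (\<forall>t. subalgebra P (F t)) \<and>
    (\<forall>t\<ge>0. W t \<in> borel_measurable (F t)) \<and>
    (AE \<omega> in P. W 0 \<omega> = 0) \<and>
    (AE \<omega> in P. continuous_on {0..} (\<lambda>t. W t \<omega>)) \<and>
    (\<forall>s t. 0 \<le> s \<and> s < t \<longrightarrow>
      distributed P lborel (\<lambda>\<omega>. W t \<omega> - W s \<omega>)
        (\<lambda>z. ennreal (\<Prod>i\<in>UNIV. normal_density 0 (sqrt (t - s)) (z $ i))) \<and>
      prob_space.indep_set P (sets (F s))
        {(\<lambda>\<omega>. W t \<omega> - W s \<omega>) -` A \<inter> space P | A. A \<in> sets borel})"

text \<open>The measurability clause matters: \<open>measure\<close> is \<open>0\<close> on non-measurable sets.\<close>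

definition vanishes_in_probability :: "'a measure \<Rightarrow> (nat \<Rightarrow> 'a \<Rightarrow> ennreal) \<Rightarrow> bool"
  where "vanishes_in_probability P Y \<longleftrightarrow>
    (\<forall>\<epsilon>>0. (\<forall>k. {\<omega> \<in> space P. \<epsilon> < Y k \<omega>} \<in> sets P) \<and>
      (\<lambda>k. measure P {\<omega> \<in> space P. \<epsilon> < Y k \<omega>}) \<longlonglongrightarrow> 0)"

text \<open>
  An elementary integrand takes the value \<open>H j\<close> on \<open>{\<tau> j <.. \<tau> (Suc j)}\<close> for \<open>j < N\<close>
  and vanishes elsewhere.
\<close>

definition elementary_integrand ::
    "'a measure \<Rightarrow> (real \<Rightarrow> 'a measure) \<Rightarrow> real \<Rightarrow> nat \<Rightarrow> (nat \<Rightarrow> real)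
      \<Rightarrow> (nat \<Rightarrow> 'a \<Rightarrow> real ^ 'n ^ 'n) \<Rightarrow> bool"
  where "elementary_integrand P F t0 N \<tau> H \<longleftrightarrow>
    t0 \<le> \<tau> 0 \<and> mono \<tau> \<and>
    (\<forall>j<N. H j \<in> borel_measurable (F (\<tau> j)) \<and> bounded (H j ` space P))"

definition elementary_value ::
    "nat \<Rightarrow> (nat \<Rightarrow> real) \<Rightarrow> (nat \<Rightarrow> 'a \<Rightarrow> real ^ 'n ^ 'n) \<Rightarrow> real \<Rightarrow> 'a \<Rightarrow> real ^ 'n ^ 'n"
  where "elementary_value N \<tau> H s \<omega> = (\<Sum>j<N. indicat_real {\<tau> j <.. \<tau> (Suc j)} s *\<^sub>R H j \<omega>)"

definition elementary_integral ::
    "(real \<Rightarrow> 'a \<Rightarrow> real ^ 'n) \<Rightarrow> nat \<Rightarrow> (nat \<Rightarrow> real) \<Rightarrow> (nat \<Rightarrow> 'a \<Rightarrow> real ^ 'n ^ 'n)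
      \<Rightarrow> real \<Rightarrow> 'a \<Rightarrow> real ^ 'n"
  where "elementary_integral W N \<tau> H t \<omega> =
    (\<Sum>j<N. H j \<omega> *v (W (min t (\<tau> (Suc j))) \<omega> - W (min t (\<tau> j)) \<omega>))"

text \<open>
  \<open>J\<close> is (a version of) the Ito integral of the matrix-valued process \<open>G\<close> against \<open>W\<close> over
  \<open>{t0..t}\<close>: a limit in probability of integrals of elementary integrands that approximate \<open>G\<close>
  in \<open>L\<^sup>2\<close> in time, in probability.
\<close>

definition is_ito_integral ::
    "'a measure \<Rightarrow> (real \<Rightarrow> 'a measure) \<Rightarrow> (real \<Rightarrow> 'a \<Rightarrow> real ^ 'n) \<Rightarrow> real \<Rightarrow> real
      \<Rightarrow> (real \<Rightarrow> 'a \<Rightarrow> real ^ 'n ^ 'n) \<Rightarrow> ('a \<Rightarrow> real ^ 'n) \<Rightarrow> bool"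
  where "is_ito_integral P F W t0 t G J \<longleftrightarrow>
    (\<exists>N \<tau> H. (\<forall>k. elementary_integrand P F t0 (N k) (\<tau> k) (H k)) \<and>
      vanishes_in_probability P (\<lambda>k \<omega>.
        \<integral>\<^sup>+s\<in>{t0..t}. ennreal ((norm (elementary_value (N k) (\<tau> k) (H k) s \<omega> - G s \<omega>))\<^sup>2) \<partial>lborel) \<and>
      vanishes_in_probability P (\<lambda>k \<omega>.
        ennreal (norm (elementary_integral W (N k) (\<tau> k) (H k) t \<omega> - J \<omega>))))"

definition sde_solution ::
    "'a measure \<Rightarrow> (real \<Rightarrow> 'a measure) \<Rightarrow> (real \<Rightarrow> 'a \<Rightarrow> real ^ 'n)
      \<Rightarrow> (real ^ 'n \<Rightarrow> real \<Rightarrow> real ^ 'n) \<Rightarrow> (real ^ 'n \<Rightarrow> real \<Rightarrow> real ^ 'n ^ 'n)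
      \<Rightarrow> real \<Rightarrow> real \<Rightarrow> real ^ 'n \<Rightarrow> (real \<Rightarrow> 'a \<Rightarrow> real ^ 'n) \<Rightarrow> bool"
  where "sde_solution P F W f g t0 T x0 X \<longleftrightarrow>
    (\<forall>t\<in>{t0..<T}. X t \<in> borel_measurable (F t)) \<and>
    (AE \<omega> in P. continuous_on {t0..<T} (\<lambda>t. X t \<omega>)) \<and>
    (AE \<omega> in P. X t0 \<omega> = x0) \<and>
    (\<forall>t\<in>{t0..<T}.
      (AE \<omega> in P. set_integrable lborel {t0..t} (\<lambda>s. f (X s \<omega>) s)) \<and>
      (\<exists>J. is_ito_integral P F W t0 t (\<lambda>s \<omega>. g (X s \<omega>) s) J \<and>
        (AE \<omega> in P. X t \<omega> = X t0 \<omega> + (LINT s:{t0..t}|lborel. f (X s \<omega>) s) + J \<omega>)))"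


section \<open>Moment dynamics\<close>

definition partial_deriv :: "'n \<Rightarrow> (real ^ 'n \<Rightarrow> real) \<Rightarrow> real ^ 'n \<Rightarrow> real"
  where "partial_deriv i h x = deriv (\<lambda>s. h (x + s *\<^sub>R axis i 1)) 0"

text \<open>All moments are finite and obey the moment evolution equation on \<open>S\<close>.\<close>

definition moments_evolve ::
    "'a measure \<Rightarrow> (real ^ 'n \<Rightarrow> real \<Rightarrow> real ^ 'n) \<Rightarrow> (real ^ 'n \<Rightarrow> real \<Rightarrow> real ^ 'n ^ 'n)
      \<Rightarrow> real set \<Rightarrow> (real \<Rightarrow> 'a \<Rightarrow> real ^ 'n) \<Rightarrow> bool"
  where "moments_evolve P f g S X \<longleftrightarrow>
    (\<forall>q. \<forall>t\<in>S. integrable P (\<lambda>\<omega>. mpow (X t \<omega>) q) \<and>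
      ((moment P X q) has_real_derivative
        (\<Sum>i\<in>UNIV. \<integral>\<omega>. f (X t \<omega>) t $ i * partial_deriv i (\<lambda>x. mpow x q) (X t \<omega>) \<partial>P)
        + 1 / 2 * (\<Sum>i\<in>UNIV. \<Sum>j\<in>UNIV. \<integral>\<omega>.
            (g (X t \<omega>) t ** transpose (g (X t \<omega>) t)) $ i $ j *
            partial_deriv i (partial_deriv j (\<lambda>x. mpow x q)) (X t \<omega>) \<partial>P))
        (at t within S))"

text \<open>
  \<open>a\<close>, \<open>A\<close>, \<open>B\<close> are read off from \<open>f\<close> and \<open>g\<close> by expanding the right-hand side of the moment
  evolution equation for \<open>m s\<close>, before taking expectations, in monomials in \<open>x\<close>. As \<open>m\<close> and \<open>mb\<close>
  enumerate pairwise distinct nonzero multi-indices, this determines them uniquely on \<open>S\<close>; taking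
  expectations gives \<open>d\<mu>/dt = a + A \<mu> + B \<mu>b\<close>.
\<close>

definition moment_dynamics_coeffs ::
    "(real ^ 'n \<Rightarrow> real \<Rightarrow> real ^ 'n) \<Rightarrow> (real ^ 'n \<Rightarrow> real \<Rightarrow> real ^ 'n ^ 'n) \<Rightarrow> real set
      \<Rightarrow> ('k \<Rightarrow> nat ^ 'n) \<Rightarrow> ('r \<Rightarrow> nat ^ 'n)
      \<Rightarrow> (real \<Rightarrow> real ^ 'k) \<Rightarrow> (real \<Rightarrow> real ^ 'k ^ 'k) \<Rightarrow> (real \<Rightarrow> real ^ 'r ^ 'k) \<Rightarrow> bool"
  where "moment_dynamics_coeffs f g S m mb a A B \<longleftrightarrow>
    (\<forall>t\<in>S. \<forall>x s.
      (\<Sum>i\<in>UNIV. f x t $ i * partial_deriv i (\<lambda>y. mpow y (m s)) x)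
      + 1 / 2 * (\<Sum>i\<in>UNIV. \<Sum>j\<in>UNIV. (g x t ** transpose (g x t)) $ i $ j *
            partial_deriv i (partial_deriv j (\<lambda>y. mpow y (m s))) x)
      = (a t + A t *v (\<chi> p. mpow x (m p)) + B t *v (\<chi> q. mpow x (mb q))) $ s)"


section \<open>Moment closure\<close>

text \<open>
  Real powers of possibly negative bases: \<open>x powr a\<close> is only meaningful for \<open>x > 0\<close>, whereas
  integer exponents make sense for every nonzero base. Where \<open>real_pow_defined\<close> fails,
  \<open>real_pow\<close> has no mathematical meaning.
\<close>

definition real_pow :: "real \<Rightarrow> real \<Rightarrow> real"
  where "real_pow x a = (if a \<in> \<int> then x powi \<lfloor>a\<rfloor> else x powr a)"

definition real_pow_defined :: "real \<Rightarrow> real \<Rightarrow> bool"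
  where "real_pow_defined x a \<longleftrightarrow> 0 < x \<or> (x = 0 \<and> 0 \<le> a) \<or> (x < 0 \<and> a \<in> \<int>)"

definition closure_exponents :: "('k::finite \<Rightarrow> nat ^ 'n) \<Rightarrow> nat ^ 'n \<Rightarrow> real ^ 'k"
  where "closure_exponents m q = (THE \<alpha>. \<forall>s.
    real (mchoose q (m s)) = (\<Sum>p\<in>UNIV. \<alpha> $ p * real (mchoose (m p) (m s))))"

definition closure_fun ::
    "('k::finite \<Rightarrow> nat ^ 'n) \<Rightarrow> ('r \<Rightarrow> nat ^ 'n) \<Rightarrow> real ^ 'k \<Rightarrow> real ^ 'r"
  where "closure_fun m mb v =
    (\<chi> q. \<Prod>p\<in>UNIV. real_pow (v $ p) (closure_exponents m (mb q) $ p))"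

text \<open>
  As for any differential equation whose right-hand side is a partial function, a solution stays
  where the right-hand side is defined. Entries of the closure function with a vanishing column
  in \<open>B\<close> do not occur in the closed system and need not be defined.
\<close>

definition closed_system_solution ::
    "real set \<Rightarrow> ('k::finite \<Rightarrow> nat ^ 'n) \<Rightarrow> ('r::finite \<Rightarrow> nat ^ 'n)
      \<Rightarrow> (real \<Rightarrow> real ^ 'k) \<Rightarrow> (real \<Rightarrow> real ^ 'k ^ 'k) \<Rightarrow> (real \<Rightarrow> real ^ 'r ^ 'k)
      \<Rightarrow> (real \<Rightarrow> real ^ 'k) \<Rightarrow> bool"
  where "closed_system_solution S m mb a A B \<nu> \<longleftrightarrow>
    (\<forall>t\<in>S.
      (\<forall>q. (\<exists>u\<in>S. column q (B u) \<noteq> 0) \<longrightarrow>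
        (\<forall>p. real_pow_defined (\<nu> t $ p) (closure_exponents m (mb q) $ p))) \<and>
      (\<nu> has_vector_derivative (a t + A t *v \<nu> t + B t *v closure_fun m mb (\<nu> t)))
        (at t within S))"

end

theory Submission
  imports
    Defs
    "HOL-Computational_Algebra.Primes"
    "HOL-Computational_Algebra.Polynomial"
begin

text \<open>
  For a point mass at \<open>x\<close> with nonzero coordinates, the equations of the binomial system with
  \<open>|m\<^sub>s| = 1\<close> say that the closure function reproduces the higher moments exactly,
  \<open>\<phi>((x\<^bsup>[m]\<^esup>)\<^sub>m) = x\<^bsup>[mb]\<^esup>\<close>, and those with \<open>|m\<^sub>s| = 2\<close> that the chain rule
  \<open>\<Sum>\<^sub>p \<partial>\<^sub>p\<phi> \<cdot> L x\<^bsup>[m\<^sub>p]\<^esup> = L x\<^bsup>[mb]\<^esup>\<close> holds for the second-order generator \<open>L\<close>. The binomial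
  system is integrally unitriangular, so the exponents are integers; hence, wherever \<open>\<phi>\<close> is
  defined, it is locally rational, and both identities extend by continuity to points with
  vanishing coordinates. They give equal first derivatives of \<open>\<mu>\<close> and \<open>\<nu>\<close>, and equal values and
  first derivatives of \<open>\<mu>b\<close> and \<open>\<phi>(\<nu>)\<close>, at \<open>t0\<close>. The coefficients \<open>a\<close>, \<open>A\<close>, \<open>B\<close> are
  differentiable at \<open>t0\<close>, because they are linear combinations of values of \<open>L x\<^bsup>[m]\<^esup>\<close> at finitely
  many points \<open>x\<close>, so differentiating both systems once more gives equal second derivatives.
\<close>

section \<open>Closure exponents\<close>

lemma mchoose_self [simp]: "mchoose q q = 1"
  by (simp add: mchoose_def)

lemma mdeg_strict_mono: "l < h \<Longrightarrow> mdeg l < mdeg h"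
  unfolding mdeg_def
  by (rule sum_strict_mono_ex1) (auto simp: less_vec_def less_eq_vec_def not_le)

lemma mchoose_eq_0: "\<not> l \<le> h \<Longrightarrow> mchoose h l = 0"
  unfolding mchoose_def less_eq_vec_def by (auto simp: not_le)

text \<open>A nonzero \<open>mchoose h l\<close> forces \<open>l \<le> h\<close> componentwise,
  hence strictly smaller degree unless \<open>l = h\<close>. This is the source of
  triangularity.\<close>

lemma mchoose_eq_0_deg: "mdeg h \<le> mdeg l \<Longrightarrow> h \<noteq> l \<Longrightarrow> mchoose h l = 0"
  by (metis leD mchoose_eq_0 mdeg_strict_mono order_le_less)

text \<open>The binomial system is unitriangular with respect to the degree, so that coefficients can be
  determined one at a time, by descending degree.\<close>

lemma mchoose_system_row:
  fixes m :: "'k::finite \<Rightarrow> nat ^ 'n" and \<beta> :: "real ^ 'k"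
  assumes "inj m"
  shows "(\<Sum>p\<in>UNIV. \<beta> $ p * real (mchoose (m p) (m s)))
    = \<beta> $ s + (\<Sum>p | mdeg (m s) < mdeg (m p). \<beta> $ p * real (mchoose (m p) (m s)))"
proof -
  have "(\<Sum>p\<in>UNIV. \<beta> $ p * real (mchoose (m p) (m s)))
      = (\<Sum>p\<in>insert s {p. mdeg (m s) < mdeg (m p)}. \<beta> $ p * real (mchoose (m p) (m s)))"
    using assms by (intro sum.mono_neutral_right) (auto simp: not_less mchoose_eq_0_deg inj_eq)
  then show ?thesis by simp
qed

lemma degree_descending_induct:
  fixes m :: "'k \<Rightarrow> nat ^ 'n"
  assumes "\<And>p. mdeg (m p) \<le> M"
    and "\<And>s. (\<And>p. mdeg (m s) < mdeg (m p) \<Longrightarrow> Q p) \<Longrightarrow> Q s"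
  shows "Q s"
proof (induction "M - mdeg (m s)" arbitrary: s rule: less_induct)
  case less
  show ?case
    by (rule assms(2), rule less) (use assms(1) in \<open>metis diff_less_mono2 less_le_trans\<close>)
qed

lemma mchoose_system_unique:
  fixes m :: "'k::finite \<Rightarrow> nat ^ 'n" and \<beta> :: "real ^ 'k"
  assumes "inj m" and le: "\<And>p. mdeg (m p) \<le> M"
    and zero: "\<And>s. (\<Sum>p\<in>UNIV. \<beta> $ p * real (mchoose (m p) (m s))) = 0"
  shows "\<beta> = 0"
proof -
  have "\<beta> $ s = 0" for s
  proof (induction s rule: degree_descending_induct[where m = m and M = M])
    case (2 s)
    have "(\<Sum>p | mdeg (m s) < mdeg (m p). \<beta> $ p * real (mchoose (m p) (m s))) = 0"
      using 2 by (intro sum.neutral) auto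
    then show ?case using mchoose_system_row[OF \<open>inj m\<close>, of \<beta> s] zero[of s] by simp
  qed (rule le)
  then show ?thesis by (simp add: vec_eq_iff)
qed

text \<open>The diagonal entries are 1, so back-substitution never divides and stays within the
  integers.\<close>

lemma mchoose_system_ints:
  fixes m :: "'k::finite \<Rightarrow> nat ^ 'n" and \<alpha> :: "real ^ 'k"
  assumes "inj m" and le: "\<And>p. mdeg (m p) \<le> M"
    and sys: "\<And>s. real (mchoose q (m s)) = (\<Sum>p\<in>UNIV. \<alpha> $ p * real (mchoose (m p) (m s)))"
  shows "\<alpha> $ s \<in> \<int>"
proof (induction s rule: degree_descending_induct[where m = m and M = M])
  case (2 s)
  have "\<alpha> $ s = real (mchoose q (m s))
      - (\<Sum>p | mdeg (m s) < mdeg (m p). \<alpha> $ p * real (mchoose (m p) (m s)))"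
    using mchoose_system_row[OF \<open>inj m\<close>, of \<alpha> s] sys[of s] by simp
  also have "\<dots> \<in> \<int>"
    using 2 by (intro Ints_diff Ints_sum Ints_mult) auto
  finally show ?case .
qed (rule le)

lemma mchoose_system_ex1:
  fixes m :: "'k::finite \<Rightarrow> nat ^ 'n"
  assumes "inj m" and le: "\<And>p. mdeg (m p) \<le> M"
  shows "\<exists>!\<alpha> :: real ^ 'k.
    \<forall>s. real (mchoose q (m s)) = (\<Sum>p\<in>UNIV. \<alpha> $ p * real (mchoose (m p) (m s)))"
proof -
  define C :: "real ^ 'k ^ 'k" where "C = (\<chi> s p. real (mchoose (m p) (m s)))"
  have C: "(C *v \<beta>) $ s = (\<Sum>p\<in>UNIV. \<beta> $ p * real (mchoose (m p) (m s)))" for \<beta> s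
    by (simp add: C_def matrix_vector_mult_def mult.commute)
  have lin: "linear ((*v) C)" by simp
  have inj: "inj ((*v) C)"
    unfolding linear_injective_0[OF lin]
    using mchoose_system_unique[OF assms] C by (metis zero_index)
  \<comment> \<open>The system has as many equations as unknowns, so uniqueness already yields
    existence.\<close>
  then have "surj ((*v) C)"
    using linear_injective_imp_surjective[OF lin] by auto
  then obtain \<alpha> where "C *v \<alpha> = (\<chi> s. real (mchoose q (m s)))"
    by (metis surjD)
  then have \<alpha>: "\<forall>s. real (mchoose q (m s)) = (C *v \<alpha>) $ s" by simp
  show ?thesis
  proof (rule ex1I[of _ \<alpha>])
    fix \<beta> assume "\<forall>s. real (mchoose q (m s)) = (\<Sum>p\<in>UNIV. \<beta> $ p * real (mchoose (m p) (m s)))"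
    then have "C *v \<beta> = C *v \<alpha>" using \<alpha> C by (simp add: vec_eq_iff)
    then show "\<beta> = \<alpha>" using inj by (simp add: inj_eq)
  qed (use \<alpha> C in simp)
qed

lemma closure_exponents_system:
  fixes m :: "'k::finite \<Rightarrow> nat ^ 'n"
  assumes "inj m" and "\<And>p. mdeg (m p) \<le> M"
  shows "real (mchoose q (m s)) = (\<Sum>p\<in>UNIV. closure_exponents m q $ p * real (mchoose (m p) (m s)))"
  using theI'[OF mchoose_system_ex1[OF assms]] unfolding closure_exponents_def by blast

lemma closure_exponents_ints:
  fixes m :: "'k::finite \<Rightarrow> nat ^ 'n"
  assumes "inj m" and "\<And>p. mdeg (m p) \<le> M"
  shows "closure_exponents m q $ p \<in> \<int>"
  using mchoose_system_ints[OF assms closure_exponents_system[OF assms]] .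

section \<open>Multi-indices of degree one and two\<close>

lemma mdeg_add: "mdeg (p + q) = mdeg p + mdeg q"
  by (simp add: mdeg_def sum.distrib)

lemma mdeg_axis [simp]: "mdeg (axis i c) = c"
  by (simp add: mdeg_def axis_def)

lemma mchoose_axis: "mchoose q (axis i 1) = q $ i"
proof -
  have "mchoose q (axis i 1) = (\<Prod>j\<in>UNIV. if j = i then q $ j else 1)"
    unfolding mchoose_def by (intro prod.cong) (auto simp: axis_def)
  then show ?thesis by simp
qed

text \<open>The right-hand side is the coefficient produced by differentiating the monomial in
  directions \<open>j\<close> and \<open>i\<close>. The binomial counts unordered choices, which
  costs a factor 2 on the diagonal.\<close>

lemma mchoose_axis_axis:
  "(if i = j then 2 else 1) * mchoose q (axis i 1 + axis j 1) = q $ j * (q - axis j 1) $ i"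
proof (cases "i = j")
  case True
  have "mchoose q (axis i 1 + axis j 1) = (\<Prod>l\<in>UNIV. if l = i then (q $ l) choose 2 else 1)"
    unfolding mchoose_def using True by (intro prod.cong) (auto simp: axis_def numeral_2_eq_2)
  moreover have "2 * (q $ i choose 2) = q $ i * (q $ i - 1)"
    by (cases "q $ i") (auto simp: choose_two)
  ultimately show ?thesis
    using True by (simp add: axis_def)
next
  case False
  have "mchoose q (axis i 1 + axis j 1)
      = (\<Prod>l\<in>UNIV. (if l = i then q $ l else 1) * (if l = j then q $ l else 1))"
    unfolding mchoose_def using False by (intro prod.cong) (auto simp: axis_def)
  then show ?thesis
    using False by (simp add: axis_def prod.distrib)
qed

section \<open>The generator applied to monomials\<close>

lemma mpow_add: "mpow x (p + q) = mpow x p * mpow x q"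
  by (simp add: mpow_def power_add prod.distrib)

lemma mpow_axis [simp]: "mpow x (axis i c) = x $ i ^ c"
proof -
  have "mpow x (axis i c) = (\<Prod>j\<in>UNIV. if j = i then x $ j ^ c else 1)"
    unfolding mpow_def by (intro prod.cong) (auto simp: axis_def)
  then show ?thesis by simp
qed

lemma mpow_0 [simp]: "mpow x 0 = 1"
  by (simp add: mpow_def)

lemma mpow_nonzero: "(\<And>i. x $ i \<noteq> 0) \<Longrightarrow> mpow x q \<noteq> 0"
  by (simp add: mpow_def)

lemma tendsto_mpow [tendsto_intros]:
  "(X \<longlongrightarrow> x) F \<Longrightarrow> ((\<lambda>t. mpow (X t) q) \<longlongrightarrow> mpow x q) F"
  unfolding mpow_def by (intro tendsto_intros)

text \<open>The factor \<open>c\<close> lets the rule be applied a second time to its own result. If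
  \<open>q $ i = 0\<close>, the truncated subtraction leaves \<open>q\<close> unchanged, but the
  coefficient is then 0.\<close>

lemma partial_deriv_cmult_mpow:
  "partial_deriv i (\<lambda>y. c * mpow y q) = (\<lambda>x. c * real (q $ i) * mpow x (q - axis i 1))"
proof
  fix x :: "real ^ 'a"
  have *: "c * mpow (x + s *\<^sub>R axis i 1) q
      = c * ((x $ i + s) ^ (q $ i) * (\<Prod>j\<in>UNIV-{i}. x $ j ^ q $ j))" for s
    unfolding mpow_def by (subst prod.remove[of _ i]) (auto simp: axis_def intro!: prod.cong)
  have **: "mpow x (q - axis i 1) = x $ i ^ (q $ i - 1) * (\<Prod>j\<in>UNIV-{i}. x $ j ^ q $ j)"
    unfolding mpow_def by (subst prod.remove[of _ i]) (auto simp: axis_def intro!: prod.cong)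
  show "partial_deriv i (\<lambda>y. c * mpow y q) x = c * real (q $ i) * mpow x (q - axis i 1)"
    unfolding partial_deriv_def * **
    by (rule DERIV_imp_deriv) (auto intro!: derivative_eq_intros)
qed

lemma partial_deriv_mpow:
  "partial_deriv i (\<lambda>y. mpow y q) = (\<lambda>x. real (q $ i) * mpow x (q - axis i 1))"
  using partial_deriv_cmult_mpow[of i 1 q] by simp

lemma partial_deriv2_mpow:
  "partial_deriv i (partial_deriv j (\<lambda>y. mpow y q))
    = (\<lambda>x. real (q $ j * (q - axis j 1) $ i) * mpow x (q - axis j 1 - axis i 1))"
  by (simp add: partial_deriv_mpow partial_deriv_cmult_mpow)

text \<open>\<open>b\<close> is the drift and \<open>G\<close> the matrix \<open>g g\<^sup>T\<close>, both frozen at one point.\<close>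

definition generator :: "real ^ 'n \<Rightarrow> real ^ 'n ^ 'n \<Rightarrow> nat ^ 'n \<Rightarrow> real ^ 'n \<Rightarrow> real"
  where "generator b G q x =
    (\<Sum>i\<in>UNIV. b $ i * partial_deriv i (\<lambda>y. mpow y q) x)
    + 1 / 2 * (\<Sum>i\<in>UNIV. \<Sum>j\<in>UNIV. G $ i $ j * partial_deriv i (partial_deriv j (\<lambda>y. mpow y q)) x)"

lemma generator_eq:
  "generator b G q x = (\<Sum>i\<in>UNIV. b $ i * (real (q $ i) * mpow x (q - axis i 1)))
    + 1 / 2 * (\<Sum>i\<in>UNIV. \<Sum>j\<in>UNIV. G $ i $ j *
        (real (q $ j * (q - axis j 1) $ i) * mpow x (q - axis j 1 - axis i 1)))"
  by (simp add: generator_def partial_deriv_mpow partial_deriv_cmult_mpow)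

lemma tendsto_generator [tendsto_intros]:
  "(X \<longlongrightarrow> x) F \<Longrightarrow> ((\<lambda>t. generator b G q (X t)) \<longlongrightarrow> generator b G q x) F"
  unfolding generator_eq by (intro tendsto_intros)

text \<open>The factor \<open>q $ i\<close> stays on both sides because dividing by
  \<open>x $ i\<close> lowers the exponent correctly only when \<open>q $ i\<close> is
  positive.\<close>

lemma mult_mpow_diff_axis:
  assumes "x $ i \<noteq> 0"
  shows "real (q $ i) * mpow x (q - axis i 1) = real (q $ i) * (mpow x q / x $ i)"
proof (cases "q $ i = 0")
  case False
  then have "q = (q - axis i 1) + axis i 1"
    by (auto simp: vec_eq_iff axis_def)
  then have "mpow x q = mpow x (q - axis i 1) * x $ i"
    by (metis mpow_add mpow_axis power_one_right)
  then show ?thesis using assms by simp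
qed simp

text \<open>After division by the monomial, the generator is a combination of the binomials of
  degree 1 and 2 of \<open>q\<close>, with weights independent of \<open>q\<close>. Linear relations
  between binomials therefore carry over to generators.\<close>

lemma generator_nonzero:
  assumes nz: "\<And>i. x $ i \<noteq> 0"
  shows "generator b G q x = mpow x q *
    ((\<Sum>i\<in>UNIV. b $ i / x $ i * real (mchoose q (axis i 1)))
    + 1 / 2 * (\<Sum>i\<in>UNIV. \<Sum>j\<in>UNIV. G $ i $ j / (x $ i * x $ j) *
        ((if i = j then 2 else 1) * real (mchoose q (axis i 1 + axis j 1)))))"
proof -
  have 1: "real (q $ i) * mpow x (q - axis i 1)
      = mpow x q * real (mchoose q (axis i 1)) / x $ i" for i
    using mult_mpow_diff_axis[of x i q, OF nz] by (simp add: mchoose_axis del: One_nat_def)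
  have 2: "real (q $ j * (q - axis j 1) $ i) * mpow x (q - axis j 1 - axis i 1)
      = mpow x q * ((if i = j then 2 else 1) * real (mchoose q (axis i 1 + axis j 1))) / (x $ i * x $ j)"
    for i j
  proof -
    have "real (q $ j * (q - axis j 1) $ i) * mpow x (q - axis j 1 - axis i 1)
        = real (q $ j) * mpow x (q - axis j 1) * real ((q - axis j 1) $ i) / x $ i"
      by (simp only: of_nat_mult mult.assoc mult_mpow_diff_axis[of x i "q - axis j 1", OF nz]) simp
    also have "\<dots> = mpow x q * real (q $ j * (q - axis j 1) $ i) / (x $ i * x $ j)"
      using mult_mpow_diff_axis[of x j q, OF nz] by (simp add: field_simps)
    also have "\<dots> = mpow x q * ((if i = j then 2 else 1) * real (mchoose q (axis i 1 + axis j 1)))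
        / (x $ i * x $ j)"
      by (subst mchoose_axis_axis[symmetric]) simp
    finally show ?thesis .
  qed
  show ?thesis
    unfolding generator_eq 1 2
    by (simp add: sum_distrib_left distrib_left mult_ac)
qed

section \<open>Monomials in the moments\<close>

lemma powi_sum: "x \<noteq> 0 \<Longrightarrow> x powi (\<Sum>p\<in>I. k p) = (\<Prod>p\<in>I. x powi k p)"
  for x :: real
  by (induction I rule: infinite_finite_induct) (auto simp: power_int_add)

lemma powi_prod: "(\<Prod>i\<in>I. f i) powi k = (\<Prod>i\<in>I. f i powi k)"
  for f :: "'i \<Rightarrow> real"
  by (induction I rule: infinite_finite_induct) (auto simp: power_int_mult_distrib)

lemma prod_mpow_powi:
  fixes m :: "'k::finite \<Rightarrow> nat ^ 'n"
  assumes "\<And>i. x $ i \<noteq> 0" and "\<And>i. (\<Sum>p\<in>UNIV. k p * int (m p $ i)) = int (q $ i)"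
  shows "(\<Prod>p\<in>UNIV. mpow x (m p) powi k p) = mpow x q"
proof -
  have "(\<Prod>p\<in>UNIV. mpow x (m p) powi k p)
      = (\<Prod>p\<in>UNIV. \<Prod>i\<in>UNIV. x $ i powi (k p * int (m p $ i)))"
    by (simp add: mpow_def powi_prod power_int_power mult.commute)
  also have "\<dots> = (\<Prod>i\<in>UNIV. \<Prod>p\<in>UNIV. x $ i powi (k p * int (m p $ i)))"
    by (rule prod.swap)
  also have "\<dots> = mpow x q"
    using assms by (simp add: powi_sum[symmetric] mpow_def)
  finally show ?thesis .
qed

text \<open>The partial derivative in direction \<open>p\<close> of the product of all
  \<open>v $ l powi k l\<close>. Splitting off the factor \<open>p\<close>, instead of dividing by
  \<open>v $ p\<close>, keeps it meaningful at zeros with nonnegative exponent.\<close>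

definition dprod_powi :: "('k::finite \<Rightarrow> int) \<Rightarrow> real ^ 'k \<Rightarrow> 'k \<Rightarrow> real"
  where "dprod_powi k v p =
    of_int (k p) * v $ p powi (k p - 1) * (\<Prod>l\<in>UNIV-{p}. v $ l powi k l)"

lemma has_derivative_prod_powi:
  fixes v :: "real \<Rightarrow> real ^ 'k::finite"
  assumes d: "\<And>p. ((\<lambda>t. v t $ p) has_real_derivative v' p) (at t within S)"
    and def: "\<And>p. k p \<ge> 0 \<or> v t $ p \<noteq> 0"
  shows "((\<lambda>t. \<Prod>p\<in>UNIV. v t $ p powi k p) has_real_derivative
    (\<Sum>p\<in>UNIV. dprod_powi k (v t) p * v' p)) (at t within S)"
proof -
  have "((\<lambda>t. v t $ p powi k p) has_derivative
      (\<lambda>y. y * (of_int (k p) * v t $ p powi (k p - 1) * v' p))) (at t within S)" for p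
    using DERIV_power_int[OF d def, of p]
    by (simp add: has_field_derivative_def mult_commute_abs)
  from has_derivative_prod[OF this, where I = UNIV]
  show ?thesis
    unfolding has_field_derivative_def dprod_powi_def
    by (rule has_derivative_eq_rhs) (simp add: fun_eq_iff sum_distrib_right sum_distrib_left mult_ac)
qed

lemma tendsto_powi:
  fixes f :: "'b \<Rightarrow> real"
  assumes "(f \<longlongrightarrow> c) F" and "k \<ge> 0 \<or> c \<noteq> 0"
  shows "((\<lambda>t. f t powi k) \<longlongrightarrow> c powi k) F"
  using assms
  by (cases "k \<ge> 0") (auto simp: power_int_nonneg_exp intro: tendsto_power tendsto_power_int)

lemma tendsto_dprod_powi:
  assumes v: "(v \<longlongrightarrow> v0) F" and def: "\<And>p. k p \<ge> 0 \<or> v0 $ p \<noteq> 0"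
  shows "((\<lambda>t. dprod_powi k (v t) p) \<longlongrightarrow> dprod_powi k v0 p) F"
\<comment> \<open>For \<open>k p = 0\<close> the exponent \<open>k p - 1\<close> is negative even
  though \<open>v0 $ p\<close> may vanish; there the factor \<open>of_int (k p)\<close> makes the
  whole expression 0.\<close>
proof (cases "k p = 0")
  case False
  then have "k p - 1 \<ge> 0 \<or> v0 $ p \<noteq> 0"
    using def[of p] by auto
  then show ?thesis
    unfolding dprod_powi_def
    by (intro tendsto_mult tendsto_const tendsto_prod tendsto_powi tendsto_vec_nth v def)
qed (simp add: dprod_powi_def)

lemma dprod_powi_nonzero:
  assumes "v $ p \<noteq> 0"
  shows "dprod_powi k v p = of_int (k p) * (\<Prod>l\<in>UNIV. v $ l powi k l) / v $ p"
  using assms unfolding dprod_powi_def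
  by (subst prod.remove[of UNIV p]) (auto simp: power_int_diff)

section \<open>Extending identities across the coordinate hyperplanes\<close>

lemma eventually_off_hyperplanes:
  fixes x :: "real ^ 'n"
  shows "\<forall>\<^sub>F \<epsilon> in at 0. \<forall>i. (x + \<epsilon> *\<^sub>R 1) $ i \<noteq> 0"
proof (rule eventually_all_finite)
  fix i
  show "\<forall>\<^sub>F \<epsilon> in at 0. (x + \<epsilon> *\<^sub>R 1) $ i \<noteq> 0"
    using eventually_neq_at_within[of "- x $ i" 0 UNIV]
    by eventually_elim auto
qed

text \<open>Moving along the all-ones vector, each coordinate vanishes for a single
  \<open>\<epsilon>\<close> only, so \<open>x\<close> is a limit of points without zero
  coordinates.\<close>

lemma eq_if_eq_off_hyperplanes:
  fixes x :: "real ^ 'n" and \<Phi> \<Psi> :: "real ^ 'n \<Rightarrow> real"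
  assumes "isCont \<Phi> x" and "isCont \<Psi> x"
    and eq: "\<And>y. (\<And>i. y $ i \<noteq> 0) \<Longrightarrow> \<Phi> y = \<Psi> y"
  shows "\<Phi> x = \<Psi> x"
proof -
  have "((\<lambda>\<epsilon>. x + \<epsilon> *\<^sub>R 1) \<longlongrightarrow> x + 0 *\<^sub>R 1) (at 0)"
    by (intro tendsto_intros)
  then have lim: "((\<lambda>\<epsilon>. x + \<epsilon> *\<^sub>R 1) \<longlongrightarrow> x) (at 0)" by simp
  have "\<forall>\<^sub>F \<epsilon> in at 0. \<Phi> (x + \<epsilon> *\<^sub>R 1) = \<Psi> (x + \<epsilon> *\<^sub>R 1)"
    using eventually_off_hyperplanes[of x] by eventually_elim (use eq in blast)
  with isCont_tendsto_compose[OF assms(1) lim]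
  have "((\<lambda>\<epsilon>. \<Psi> (x + \<epsilon> *\<^sub>R 1)) \<longlongrightarrow> \<Phi> x) (at 0)"
    by (rule Lim_transform_eventually)
  then show ?thesis
    using isCont_tendsto_compose[OF assms(2) lim] by (intro tendsto_unique[of "at (0::real)"]) auto
qed

text \<open>Collects the equations of degree 1 and 2 for integer exponents; integrality gives the
  powers a meaning at negative moments.\<close>

locale binomial_exponents =
  fixes m :: "'k::finite \<Rightarrow> nat ^ 'n" and q :: "nat ^ 'n" and k :: "'k \<Rightarrow> int"
  assumes system: "\<And>l. 1 \<le> mdeg l \<Longrightarrow> mdeg l \<le> 2 \<Longrightarrow>
    (\<Sum>p\<in>UNIV. of_int (k p) * real (mchoose (m p) l)) = real (mchoose q l)"
begin

lemma first_order: "(\<Sum>p\<in>UNIV. k p * int (m p $ i)) = int (q $ i)"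
proof -
  have "real_of_int (\<Sum>p\<in>UNIV. k p * int (m p $ i)) = real_of_int (int (q $ i))"
    using system[of "axis i 1"] by (simp add: mchoose_axis del: One_nat_def)
  then show ?thesis by (simp only: of_int_eq_iff)
qed

lemma prod_powi_eq_mpow:
  assumes def: "\<And>p. k p \<ge> 0 \<or> mpow x (m p) \<noteq> 0"
  shows "(\<Prod>p\<in>UNIV. mpow x (m p) powi k p) = mpow x q"
proof (rule eq_if_eq_off_hyperplanes[of x "\<lambda>x. \<Prod>p\<in>UNIV. mpow x (m p) powi k p" "\<lambda>x. mpow x q"])
  fix y :: "real ^ 'n" assume "\<And>i. y $ i \<noteq> 0"
  then show "(\<Prod>p\<in>UNIV. mpow y (m p) powi k p) = mpow y q"
    by (rule prod_mpow_powi) (rule first_order)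
qed (simp_all only: isCont_def, (intro tendsto_prod tendsto_powi tendsto_mpow tendsto_ident_at def)+)

text \<open>The generator is a second-order operator without zeroth-order term, so the chain rule for
  \<open>x \<mapsto> \<phi>(x\<^bsup>[m]\<^esup>)\<close> only misses second derivatives of \<open>\<phi>\<close>; by the second-order part of the
  binomial system they do not contribute.\<close>

lemma generator_chain:
  assumes def: "\<And>p. k p \<ge> 0 \<or> mpow x (m p) \<noteq> 0"
  shows "(\<Sum>p\<in>UNIV. dprod_powi k (\<chi> p. mpow x (m p)) p * generator b G (m p) x) = generator b G q x"
proof (rule eq_if_eq_off_hyperplanes[of x
      "\<lambda>x. \<Sum>p\<in>UNIV. dprod_powi k (\<chi> p. mpow x (m p)) p * generator b G (m p) x"
      "\<lambda>x. generator b G q x"])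
  show "isCont (\<lambda>x. \<Sum>p\<in>UNIV. dprod_powi k (\<chi> p. mpow x (m p)) p * generator b G (m p) x) x"
    unfolding isCont_def
    using def by (intro tendsto_sum tendsto_mult tendsto_dprod_powi tendsto_vec_lambda tendsto_mpow
        tendsto_generator tendsto_ident_at) simp
  show "isCont (\<lambda>x. generator b G q x) x"
    unfolding isCont_def by (intro tendsto_generator tendsto_ident_at)
next
  fix y :: "real ^ 'n" assume y: "\<And>i. y $ i \<noteq> 0"
  \<comment> \<open>\<open>c l\<close> is the quotient of \<open>generator b G l y\<close> by
    \<open>mpow y l\<close>. It is linear in the binomials of degree 1 and 2 of \<open>l\<close>, so
    the binomial system applies to it.\<close>
  define c where "c l = (\<Sum>i\<in>UNIV. b $ i / y $ i * real (mchoose l (axis i 1)))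
    + 1 / 2 * (\<Sum>i\<in>UNIV. \<Sum>j\<in>UNIV. G $ i $ j / (y $ i * y $ j) *
        ((if i = j then 2 else 1) * real (mchoose l (axis i 1 + axis j 1))))" for l
  have c: "generator b G l y = mpow y l * c l" for l
    unfolding c_def by (rule generator_nonzero[OF y])
  have s1: "(\<Sum>p\<in>UNIV. of_int (k p) * real (mchoose (m p) (axis i 1)))
      = real (mchoose q (axis i 1))" for i
    by (rule system) auto
  have s2: "(\<Sum>p\<in>UNIV. of_int (k p) * real (mchoose (m p) (axis i 1 + axis j 1)))
      = real (mchoose q (axis i 1 + axis j 1))" for i j
    by (rule system) (auto simp: mdeg_add)
  have "(\<Sum>p\<in>UNIV. of_int (k p) * c (m p))
      = (\<Sum>p\<in>UNIV. \<Sum>i\<in>UNIV. b $ i / y $ i * (of_int (k p) * real (mchoose (m p) (axis i 1))))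
      + 1 / 2 * (\<Sum>p\<in>UNIV. \<Sum>i\<in>UNIV. \<Sum>j\<in>UNIV. G $ i $ j / (y $ i * y $ j) * ((if i = j then 2 else 1)
        * (of_int (k p) * real (mchoose (m p) (axis i 1 + axis j 1)))))"
    by (simp add: c_def distrib_left sum.distrib sum_distrib_left mult_ac)
  also have "(\<Sum>p\<in>UNIV. \<Sum>i\<in>UNIV. b $ i / y $ i * (of_int (k p) * real (mchoose (m p) (axis i 1))))
      = (\<Sum>i\<in>UNIV. b $ i / y $ i * real (mchoose q (axis i 1)))"
    by (subst sum.swap) (simp only: sum_distrib_left[symmetric] s1)
  also have "(\<Sum>p\<in>UNIV. \<Sum>i\<in>UNIV. \<Sum>j\<in>UNIV. G $ i $ j / (y $ i * y $ j) * ((if i = j then 2 else 1)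
        * (of_int (k p) * real (mchoose (m p) (axis i 1 + axis j 1)))))
      = (\<Sum>i\<in>UNIV. \<Sum>j\<in>UNIV. \<Sum>p\<in>UNIV. G $ i $ j / (y $ i * y $ j) * ((if i = j then 2 else 1)
        * (of_int (k p) * real (mchoose (m p) (axis i 1 + axis j 1)))))"
    by (subst sum.swap) (intro sum.cong refl sum.swap)
  also have "\<dots> = (\<Sum>i\<in>UNIV. \<Sum>j\<in>UNIV. G $ i $ j / (y $ i * y $ j) *
        ((if i = j then 2 else 1) * real (mchoose q (axis i 1 + axis j 1))))"
    by (simp only: sum_distrib_left[symmetric] s2)
  finally have sum_c: "(\<Sum>p\<in>UNIV. of_int (k p) * c (m p)) = c q"
    unfolding c_def .
  \<comment> \<open>Logarithmic differentiation gives \<open>k p\<close> times the product divided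
    by \<open>mpow y (m p)\<close>. The product is \<open>mpow y q\<close>, and the divisor cancels
    the monomial in the generator.\<close>
  have summand: "dprod_powi k (\<chi> p. mpow y (m p)) p * generator b G (m p) y
      = mpow y q * (of_int (k p) * c (m p))" for p
    using mpow_nonzero[OF y, of "m p"] prod_mpow_powi[OF y first_order]
    by (simp add: c dprod_powi_nonzero)
  show "(\<Sum>p\<in>UNIV. dprod_powi k (\<chi> p. mpow y (m p)) p * generator b G (m p) y)
      = generator b G q y"
    by (simp only: summand sum_distrib_left[symmetric] sum_c) (simp only: c)
qed

end

section \<open>Coefficients of the moment dynamics\<close>

text \<open>With distinct primes as coordinates, \<open>mpow x q\<close> is an integer whose prime
  factorisation spells out \<open>q\<close>.\<close>

lemma ex_mpow_inj: "\<exists>x :: real ^ 'n. inj (mpow x)"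
proof -
  obtain B :: "nat set" where "finite B" "card B = CARD('n)" and B: "B \<subseteq> {p. prime p}"
    using infinite_arbitrarily_large[OF primes_infinite] by blast
  then obtain \<pi> where \<pi>: "bij_betw \<pi> (UNIV :: 'n set) B"
    using finite_same_card_bij[of "UNIV :: 'n set" B] by auto
  have prime: "prime (\<pi> i)" for i
    using \<pi> B by (auto simp: bij_betw_def)
  have inj: "inj \<pi>"
    using \<pi> by (simp add: bij_betw_def)
  have mult: "multiplicity (\<pi> i) (\<Prod>j\<in>UNIV. \<pi> j ^ (q $ j)) = q $ i" for q :: "nat ^ 'n" and i
  proof -
    have "(\<Prod>j\<in>UNIV. \<pi> j ^ (q $ j)) = (\<Prod>r\<in>range \<pi>. r ^ (q $ inv \<pi> r))"
      by (subst prod.reindex[OF inj]) (simp add: inv_f_f[OF inj])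
    also have "multiplicity (\<pi> i) \<dots> = q $ i"
      using prime by (subst multiplicity_prod_prime_powers) (auto simp: inv_f_f[OF inj])
    finally show ?thesis .
  qed
  have mpow_\<pi>: "mpow (\<chi> i. real (\<pi> i)) q = real (\<Prod>j\<in>UNIV. \<pi> j ^ (q $ j))" for q
    by (simp add: mpow_def)
  have "inj (mpow (\<chi> i. real (\<pi> i)))"
  proof (rule injI)
    fix q q' :: "nat ^ 'n"
    assume "mpow (\<chi> i. real (\<pi> i)) q = mpow (\<chi> i. real (\<pi> i)) q'"
    then have "(\<Prod>j\<in>UNIV. \<pi> j ^ (q $ j)) = (\<Prod>j\<in>UNIV. \<pi> j ^ (q' $ j))"
      by (simp only: mpow_\<pi> of_nat_eq_iff)
    then have "q $ i = q' $ i" for i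
      using mult[of i q] mult[of i q'] by simp
    then show "q = q'" by (simp add: vec_eq_iff)
  qed
  then show ?thesis by blast
qed

text \<open>Lagrange interpolation in one variable, along the powers of a point that separates
  the monomials.\<close>

lemma ex_mpow_dual:
  fixes E :: "(nat ^ 'n) set"
  assumes "finite E"
  shows "\<exists>(d :: nat) w y. \<forall>q\<in>E. (\<Sum>l\<le>d. w l * mpow (y l) q) = (if q = e then 1 else 0)"
proof -
  obtain x :: "real ^ 'n" where x: "inj (mpow x)"
    using ex_mpow_inj by blast
  define L where "L = (\<Prod>q\<in>E-{e}. smult (1 / (mpow x e - mpow x q)) [:- mpow x q, 1:])"
  have L_e: "poly L (mpow x e) = 1"
    unfolding L_def poly_prod using x
    by (intro prod.neutral) (auto simp: inj_eq diff_divide_distrib[symmetric])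
  have L_0: "poly L (mpow x q) = 0" if "q \<in> E" "q \<noteq> e" for q
    unfolding L_def poly_prod using that assms by (auto intro!: prod_zero)
  \<comment> \<open>Raising all coordinates of \<open>x\<close> to the power \<open>l\<close> raises
    every monomial to that power, so the coefficients of \<open>L\<close> serve as weights at these
    points.\<close>
  have pow: "mpow (\<chi> i. x $ i ^ l) q = mpow x q ^ l" for l q
    by (simp add: mpow_def prod_power_distrib power_mult[symmetric] mult.commute)
  have "(\<Sum>l\<le>degree L. coeff L l * mpow (\<chi> i. x $ i ^ l) q) = poly L (mpow x q)" for q
    by (simp add: pow poly_altdef)
  then have "\<forall>q\<in>E. (\<Sum>l\<le>degree L. coeff L l * mpow (\<chi> i. x $ i ^ l) q) = (if q = e then 1 else 0)"
    using L_e L_0 by simp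
  then show ?thesis
    by (intro exI[of _ "degree L"] exI[of _ "coeff L"] exI[of _ "\<lambda>l. \<chi> i. x $ i ^ l"])
qed

text \<open>The dual weights recover each coefficient as a finite linear combination of values of
  \<open>\<Phi> t\<close> at points independent of \<open>t\<close>, so it inherits
  differentiability in \<open>t\<close>.\<close>

lemma monomial_coeffs_differentiable:
  fixes m :: "'k::finite \<Rightarrow> nat ^ 'n" and mb :: "'r::finite \<Rightarrow> nat ^ 'n"
    and \<alpha> :: "real \<Rightarrow> real" and \<beta> :: "real \<Rightarrow> 'k \<Rightarrow> real" and \<gamma> :: "real \<Rightarrow> 'r \<Rightarrow> real"
  assumes "inj m" "inj mb" and disj: "\<And>p. m p \<noteq> 0" "\<And>r. mb r \<noteq> 0" "\<And>p r. m p \<noteq> mb r"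
    and "t0 \<in> S"
    and eq: "\<And>t x. t \<in> S \<Longrightarrow>
      \<Phi> t x = \<alpha> t + (\<Sum>p\<in>UNIV. \<beta> t p * mpow x (m p)) + (\<Sum>r\<in>UNIV. \<gamma> t r * mpow x (mb r))"
    and diff: "\<And>x. (\<lambda>t. \<Phi> t x) differentiable (at t0 within S)"
  shows "\<alpha> differentiable (at t0 within S)"
    and "(\<lambda>t. \<beta> t p) differentiable (at t0 within S)"
    and "(\<lambda>t. \<gamma> t r) differentiable (at t0 within S)"
proof -
  let ?\<delta> = "\<lambda>q e. if q = e then 1 else (0 :: real)"
  \<comment> \<open>For \<open>e\<close> equal to 0, \<open>m p\<close> or \<open>mb r\<close>,
    exactly one Kronecker delta survives, leaving a single coefficient.\<close>
  have key: "(\<lambda>t. \<alpha> t * ?\<delta> 0 e + (\<Sum>p\<in>UNIV. \<beta> t p * ?\<delta> (m p) e) + (\<Sum>r\<in>UNIV. \<gamma> t r * ?\<delta> (mb r) e))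
      differentiable (at t0 within S)" for e
  proof -
    have "finite (insert 0 (range m \<union> range mb))" by simp
    from ex_mpow_dual[OF this, of e] obtain d :: nat and w y
      where dual: "\<forall>q\<in>insert 0 (range m \<union> range mb). (\<Sum>l\<le>d. w l * mpow (y l) q) = ?\<delta> q e"
      by (elim exE)
    have "(\<lambda>t. \<Sum>l\<le>d. w l * \<Phi> t (y l)) differentiable (at t0 within S)"
      using diff by (intro differentiable_sum differentiable_mult) auto
    then obtain D where D: "((\<lambda>t. \<Sum>l\<le>d. w l * \<Phi> t (y l)) has_derivative D) (at t0 within S)"
      by (auto simp: differentiable_def)
    have "(\<Sum>l\<le>d. w l * \<Phi> t (y l)) = \<alpha> t * ?\<delta> 0 e + (\<Sum>p\<in>UNIV. \<beta> t p * ?\<delta> (m p) e)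
        + (\<Sum>r\<in>UNIV. \<gamma> t r * ?\<delta> (mb r) e)" if "t \<in> S" for t
    proof -
      have "(\<Sum>l\<le>d. w l * \<Phi> t (y l)) = \<alpha> t * (\<Sum>l\<le>d. w l * mpow (y l) 0)
          + (\<Sum>l\<le>d. \<Sum>p\<in>UNIV. \<beta> t p * (w l * mpow (y l) (m p)))
          + (\<Sum>l\<le>d. \<Sum>r\<in>UNIV. \<gamma> t r * (w l * mpow (y l) (mb r)))"
        by (simp add: eq[OF that] distrib_left sum.distrib sum_distrib_left mult_ac)
      also have "\<dots> = \<alpha> t * (\<Sum>l\<le>d. w l * mpow (y l) 0)
          + (\<Sum>p\<in>UNIV. \<beta> t p * (\<Sum>l\<le>d. w l * mpow (y l) (m p)))
          + (\<Sum>r\<in>UNIV. \<gamma> t r * (\<Sum>l\<le>d. w l * mpow (y l) (mb r)))"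
        by (simp add: sum_distrib_left sum.swap[where B = "{..d}"])
      finally show ?thesis by (simp only: dual[rule_format] insert_iff Un_iff rangeI simp_thms)
    qed
    from has_derivative_transform[OF \<open>t0 \<in> S\<close> this[symmetric] D]
    show ?thesis
      unfolding differentiable_def by blast
  qed
  have [simp]: "0 \<noteq> m p" "0 \<noteq> mb r" "mb r \<noteq> m p" for p r
    using disj by metis+
  show "\<alpha> differentiable (at t0 within S)"
    using key[of 0] disj by simp
  show "(\<lambda>t. \<beta> t p) differentiable (at t0 within S)"
    using key[of "m p"] disj \<open>inj m\<close> by (simp add: inj_eq if_distrib[of "(*) _"] cong: if_cong)
  show "(\<lambda>t. \<gamma> t r) differentiable (at t0 within S)"
    using key[of "mb r"] disj \<open>inj mb\<close> by (simp add: inj_eq if_distrib[of "(*) _"] cong: if_cong)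
qed

section \<open>Evolution of the moments\<close>

lemma polynomial_function_vec_nth:
  fixes f :: "'b::real_normed_vector \<Rightarrow> real ^ 'n"
  shows "polynomial_function f \<Longrightarrow> real_polynomial_function (\<lambda>x. f x $ i)"
  unfolding polynomial_function_def by (auto simp: o_def)

lemma polynomial_function_mat_nth:
  fixes f :: "'b::real_normed_vector \<Rightarrow> real ^ 'n ^ 'k"
  assumes "polynomial_function f"
  shows "real_polynomial_function (\<lambda>x. f x $ i $ j)"
proof -
  have "bounded_linear (\<lambda>z :: real ^ 'n ^ 'k. z $ i $ j)"
    by (rule bounded_linear_compose[OF bounded_linear_vec_nth bounded_linear_vec_nth])
  then show ?thesis
    using assms unfolding polynomial_function_def by (auto simp: o_def)
qed

lemma matrix_mult_transpose_nth:
  "(A ** transpose A) $ i $ j = (\<Sum>l\<in>UNIV. A $ i $ l * A $ j $ l)"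
  by (simp add: matrix_matrix_mult_def transpose_def)

text \<open>The factor \<open>h\<close> makes the induction go through for products.\<close>

lemma integrable_polynomial_mult_mpow:
  fixes X :: "'a \<Rightarrow> real ^ 'n"
  assumes "real_polynomial_function p" and "\<And>q. integrable P (\<lambda>\<omega>. h \<omega> * mpow (X \<omega>) q)"
  shows "integrable P (\<lambda>\<omega>. p (X \<omega>) * h \<omega> * mpow (X \<omega>) q)"
  using assms
proof (induction p arbitrary: h q rule: real_polynomial_function.induct)
  case (linear l)
  \<comment> \<open>In the standard basis only coordinate factors remain, and such a factor merely
    raises the multi-index by \<open>axis i 1\<close>.\<close>
  have l: "l x = (\<Sum>i\<in>UNIV. l (axis i 1) * x $ i)" for x
  proof -
    have "l x = l (\<Sum>i\<in>UNIV. (x $ i) *\<^sub>R axis i 1)"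
      by (simp add: basis_expansion scalar_mult_eq_scaleR[symmetric])
    also have "\<dots> = (\<Sum>i\<in>UNIV. l (axis i 1) * x $ i)"
      using bounded_linear.linear[OF linear(1)]
      by (simp add: linear_sum linear_scale mult.commute)
    finally show ?thesis .
  qed
  have "l (X \<omega>) * h \<omega> * mpow (X \<omega>) q
      = (\<Sum>i\<in>UNIV. l (axis i 1) * (h \<omega> * mpow (X \<omega>) (q + axis i 1)))" for \<omega>
    by (simp add: l[of "X \<omega>"] mpow_add sum_distrib_left sum_distrib_right mult_ac)
  then show ?case
    using linear(2) by simp
next
  case (const c)
  then show ?case by (simp add: mult.assoc)
next
  case (add p1 p2)
  then show ?case by (simp add: distrib_right)
next
  case (mult p1 p2)
  have "integrable P (\<lambda>\<omega>. p1 (X \<omega>) * (p2 (X \<omega>) * h \<omega>) * mpow (X \<omega>) q)"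
    by (intro mult.IH(1) mult.IH(2) mult.prems)
  then show ?case by (simp add: mult.assoc)
qed

lemma integrable_polynomial_mpow:
  fixes X :: "'a \<Rightarrow> real ^ 'n"
  assumes "real_polynomial_function p" and "\<And>q. integrable P (\<lambda>\<omega>. mpow (X \<omega>) q)"
  shows "integrable P (\<lambda>\<omega>. p (X \<omega>) * (c * mpow (X \<omega>) q))"
  using integrable_polynomial_mult_mpow[OF assms(1), of P "\<lambda>_. 1" X q] assms(2)
  by (simp add: mult.left_commute[of _ c])

text \<open>Dynkin's formula in differential form. Drift and diffusion are polynomial in
  \<open>x\<close>, so each term is integrable and expectation commutes with the sums.\<close>

lemma moments_evolve_generator:
  fixes X :: "real \<Rightarrow> 'a \<Rightarrow> real ^ 'n"
  assumes evolve: "moments_evolve P f g S X" and "t \<in> S"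
    and f_poly: "polynomial_function (\<lambda>x. f x t)" and g_poly: "polynomial_function (\<lambda>x. g x t)"
  defines "L \<equiv> \<lambda>q x. generator (f x t) (g x t ** transpose (g x t)) q x"
  shows "integrable P (\<lambda>\<omega>. L q (X t \<omega>))"
    and "(moment P X q has_real_derivative (\<integral>\<omega>. L q (X t \<omega>) \<partial>P)) (at t within S)"
proof -
  have int: "integrable P (\<lambda>\<omega>. mpow (X t \<omega>) q)" for q
    using evolve \<open>t \<in> S\<close> by (simp add: moments_evolve_def)
  have 1: "integrable P (\<lambda>\<omega>. f (X t \<omega>) t $ i * partial_deriv i (\<lambda>x. mpow x q) (X t \<omega>))" for i
    using integrable_polynomial_mpow[OF polynomial_function_vec_nth[OF f_poly] int]
    by (simp add: partial_deriv_mpow)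
  have "real_polynomial_function (\<lambda>x. (g x t ** transpose (g x t)) $ i $ j)" for i j
    unfolding matrix_mult_transpose_nth
    by (intro real_polynomial_function_sum real_polynomial_function.intros(4)
        polynomial_function_mat_nth g_poly) auto
  from integrable_polynomial_mpow[OF this int]
  have 2: "integrable P (\<lambda>\<omega>. (g (X t \<omega>) t ** transpose (g (X t \<omega>) t)) $ i $ j *
      partial_deriv i (partial_deriv j (\<lambda>x. mpow x q)) (X t \<omega>))" for i j
    by (simp only: partial_deriv2_mpow)
  show "integrable P (\<lambda>\<omega>. L q (X t \<omega>))"
    unfolding L_def generator_def
    by (intro Bochner_Integration.integrable_add integrable_mult_right
        Bochner_Integration.integrable_sum 1 2)
  have "(\<integral>\<omega>. L q (X t \<omega>) \<partial>P) =
      (\<Sum>i\<in>UNIV. \<integral>\<omega>. f (X t \<omega>) t $ i * partial_deriv i (\<lambda>x. mpow x q) (X t \<omega>) \<partial>P)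
        + 1 / 2 * (\<Sum>i\<in>UNIV. \<Sum>j\<in>UNIV. \<integral>\<omega>.
            (g (X t \<omega>) t ** transpose (g (X t \<omega>) t)) $ i $ j *
            partial_deriv i (partial_deriv j (\<lambda>x. mpow x q)) (X t \<omega>) \<partial>P)"
    unfolding L_def generator_def
    by (subst Bochner_Integration.integral_add)
      (simp_all only: 1 2 Bochner_Integration.integrable_sum integrable_mult_right
        Bochner_Integration.integral_sum integral_mult_right_zero)
  then show "(moment P X q has_real_derivative (\<integral>\<omega>. L q (X t \<omega>) \<partial>P)) (at t within S)"
    using evolve \<open>t \<in> S\<close> by (simp add: moments_evolve_def)
qed

section \<open>Matching derivatives\<close>

lemma has_vector_derivative_vec_iff:
  fixes v :: "real \<Rightarrow> real ^ 'k"
  shows "(v has_vector_derivative v') (at t within S) \<longleftrightarrow>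
    (\<forall>i. ((\<lambda>t. v t $ i) has_real_derivative v' $ i) (at t within S))"
proof -
  have "(v has_vector_derivative v') (at t within S) \<longleftrightarrow>
      (\<forall>b\<in>Basis. ((\<lambda>t. v t \<bullet> b) has_derivative (\<lambda>h. (h *\<^sub>R v') \<bullet> b)) (at t within S))"
    unfolding has_vector_derivative_def by (rule has_derivative_componentwise_within)
  also have "\<dots> \<longleftrightarrow> (\<forall>i. ((\<lambda>t. v t $ i) has_derivative (\<lambda>h. h * v' $ i)) (at t within S))"
    by (auto simp: Basis_vec_def inner_axis)
  finally show ?thesis
    by (simp add: has_field_derivative_def mult_commute_abs)
qed

lemma differentiable_vec_nth:
  "v differentiable F \<Longrightarrow> (\<lambda>t. v t $ i) differentiable F"
  for v :: "'b::real_normed_vector \<Rightarrow> ('c::real_normed_vector) ^ 'k"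
  unfolding differentiable_def
  using bounded_linear.has_derivative[OF bounded_linear_vec_nth] by blast

lemma differentiable_generator:
  assumes "b differentiable (at t0 within S)" and "G differentiable (at t0 within S)"
  shows "(\<lambda>t. generator (b t) (G t ** transpose (G t)) q x) differentiable (at t0 within S)"
  unfolding generator_def matrix_mult_transpose_nth
  by (intro differentiable_add differentiable_sum differentiable_mult differentiable_const
      differentiable_vec_nth assms finite ballI)

lemma mat_vec_nth: "(A *v u) $ s = (\<Sum>p\<in>UNIV. A $ s $ p * u $ p)"
  by (simp add: matrix_vector_mult_def)

text \<open>By the product rule the derivative depends on \<open>u\<close> and \<open>w\<close> only
  through their values and first derivatives at \<open>t0\<close>. Fixing \<open>D\<close> before
  \<open>u\<close> and \<open>w\<close> lets one vector serve both systems.\<close>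

lemma affine_system_common_derivative:
  fixes a :: "real \<Rightarrow> real ^ 'k" and A :: "real \<Rightarrow> real ^ 'l ^ 'k" and B :: "real \<Rightarrow> real ^ 'r ^ 'k"
  assumes a: "\<And>s. (\<lambda>t. a t $ s) differentiable (at t0 within S)"
    and A: "\<And>s p. (\<lambda>t. A t $ s $ p) differentiable (at t0 within S)"
    and B: "\<And>s r. (\<lambda>t. B t $ s $ r) differentiable (at t0 within S)"
  obtains D where "\<And>u w. u t0 = u0 \<Longrightarrow> w t0 = w0 \<Longrightarrow>
      (u has_vector_derivative u') (at t0 within S) \<Longrightarrow>
      (w has_vector_derivative w') (at t0 within S) \<Longrightarrow>
      ((\<lambda>t. a t + A t *v u t + B t *v w t) has_vector_derivative D) (at t0 within S)"
proof -
  obtain a' where a': "\<And>s. ((\<lambda>t. a t $ s) has_real_derivative a' s) (at t0 within S)"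
    using a unfolding real_differentiable_def by metis
  obtain A' where A': "\<And>s p. ((\<lambda>t. A t $ s $ p) has_real_derivative A' s p) (at t0 within S)"
    using A unfolding real_differentiable_def by metis
  obtain B' where B': "\<And>s r. ((\<lambda>t. B t $ s $ r) has_real_derivative B' s r) (at t0 within S)"
    using B unfolding real_differentiable_def by metis
  show thesis
  proof (rule that)
    fix u w assume "u t0 = u0" "w t0 = w0"
      and "(u has_vector_derivative u') (at t0 within S)"
      and "(w has_vector_derivative w') (at t0 within S)"
    then show "((\<lambda>t. a t + A t *v u t + B t *v w t) has_vector_derivative
        (\<chi> s. a' s + (\<Sum>p\<in>UNIV. A' s p * u0 $ p + u' $ p * A t0 $ s $ p)
          + (\<Sum>r\<in>UNIV. B' s r * w0 $ r + w' $ r * B t0 $ s $ r))) (at t0 within S)"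
      unfolding has_vector_derivative_vec_iff vector_add_component mat_vec_nth vec_lambda_beta
      by (intro allI DERIV_add DERIV_sum a') (auto intro!: DERIV_mult A' B')
  qed
qed

lemma (in prob_space) integral_AE_const:
  fixes h :: "'b \<Rightarrow> real"
  assumes "integrable M (\<lambda>\<omega>. h (Y \<omega>))" and "AE \<omega> in M. Y \<omega> = y"
  shows "(\<integral>\<omega>. h (Y \<omega>) \<partial>M) = h y"
proof -
  have "(\<integral>\<omega>. h (Y \<omega>) \<partial>M) = (\<integral>\<omega>. h y \<partial>M)"
    using assms by (intro integral_cong_AE) auto
  then show ?thesis by (simp add: prob_space)
qed

text \<open>Ensures that derivatives within the interval are unique, including the one-sided
  derivative at \<open>t0\<close>.\<close>

lemma at_within_Ico_neq_bot:
  fixes t t0 T :: real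
  assumes "t \<in> {t0..<T}"
  shows "at t within {t0..<T} \<noteq> bot"
proof -
  have "t islimpt {t0..<T}"
  proof (rule connected_imp_perfect)
    show "{t0..<T} \<noteq> {x}" for x
    proof
      assume "{t0..<T} = {x}"
      moreover have "t0 \<in> {t0..<T}" "(t0 + T) / 2 \<in> {t0..<T}" "t0 \<noteq> (t0 + T) / 2"
        using assms by auto
      ultimately show False by (metis singletonD)
    qed
  qed (use assms in auto)
  then show ?thesis by (simp add: trivial_limit_within)
qed

section \<open>Moment closure\<close>

text \<open>With \<open>2 \<le> M\<close>, every multi-index of degree 1 or 2 is some
  \<open>m s\<close>, so its equation belongs to the binomial system.\<close>

locale truncated_moments =
  fixes M :: nat and m :: "'k::finite \<Rightarrow> nat ^ 'n"
  assumes two_le: "2 \<le> M" and m: "bij_betw m UNIV {q. 1 \<le> mdeg q \<and> mdeg q \<le> M}"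
begin

lemma inj_m: "inj m"
  using m by (simp add: bij_betw_def)

lemma range_m: "range m = {q. 1 \<le> mdeg q \<and> mdeg q \<le> M}"
  using m by (simp add: bij_betw_def)

lemma mdeg_m: "1 \<le> mdeg (m p)" "mdeg (m p) \<le> M"
  using range_m by blast+

definition exponent :: "nat ^ 'n \<Rightarrow> 'k \<Rightarrow> int"
  where "exponent q p = \<lfloor>closure_exponents m q $ p\<rfloor>"

lemma of_int_exponent: "of_int (exponent q p) = closure_exponents m q $ p"
  using closure_exponents_ints[OF inj_m mdeg_m(2)] by (simp add: exponent_def)

lemma real_pow_exponent: "real_pow v (closure_exponents m q $ p) = v powi exponent q p"
  using closure_exponents_ints[OF inj_m mdeg_m(2)] by (simp add: real_pow_def exponent_def)

lemma real_pow_defined_exponent: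
  "real_pow_defined v (closure_exponents m q $ p) \<Longrightarrow> exponent q p \<ge> 0 \<or> v \<noteq> 0"
  unfolding real_pow_defined_def exponent_def by auto

lemma binomial_exponents: "binomial_exponents m q (exponent q)"
proof
  fix l :: "nat ^ 'n" assume "1 \<le> mdeg l" "mdeg l \<le> 2"
  then have "l \<in> range m"
    unfolding range_m using two_le by simp
  then obtain s where l: "l = m s" ..
  show "(\<Sum>p\<in>UNIV. of_int (exponent q p) * real (mchoose (m p) l)) = real (mchoose q l)"
    unfolding l of_int_exponent by (rule closure_exponents_system[OF inj_m mdeg_m(2), symmetric])
qed

lemma closure_fun_nth: "closure_fun m mb v $ r = (\<Prod>p\<in>UNIV. v $ p powi exponent (mb r) p)"
  by (simp add: closure_fun_def real_pow_exponent)

lemma closure_fun_mpow: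
  assumes "\<And>p. real_pow_defined (mpow x (m p)) (closure_exponents m (mb r) $ p)"
  shows "closure_fun m mb (\<chi> p. mpow x (m p)) $ r = mpow x (mb r)"
  using binomial_exponents.prod_powi_eq_mpow[OF binomial_exponents real_pow_defined_exponent[OF assms]]
  by (simp add: closure_fun_nth)

text \<open>Any curve passing through the moments of a point mass with the generator values as
  velocity is mapped by the closure to one with the matching velocity; this combines the ordinary
  chain rule with \<open>generator_chain\<close>.\<close>

lemma has_derivative_closure_fun:
  assumes "\<And>p. real_pow_defined (mpow x (m p)) (closure_exponents m (mb r) $ p)"
    and "\<And>p. ((\<lambda>t. v t $ p) has_real_derivative generator b G (m p) x) (at t0 within S)"
    and v: "v t0 = (\<chi> p. mpow x (m p))"
  shows "((\<lambda>t. closure_fun m mb (v t) $ r) has_real_derivative generator b G (mb r) x) (at t0 within S)"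
proof -
  note def = real_pow_defined_exponent[OF assms(1)]
  have "((\<lambda>t. closure_fun m mb (v t) $ r) has_real_derivative
      (\<Sum>p\<in>UNIV. dprod_powi (exponent (mb r)) (v t0) p * generator b G (m p) x)) (at t0 within S)"
    unfolding closure_fun_nth
    using def by (intro has_derivative_prod_powi assms(2)) (simp add: v)
  then show ?thesis
    using binomial_exponents.generator_chain[OF binomial_exponents def] by (simp add: v)
qed

end

theorem theorem1:
  fixes P :: "'a measure"
    and F :: "real \<Rightarrow> 'a measure"
    and W X :: "real \<Rightarrow> 'a \<Rightarrow> real ^ 'n"
    and f :: "real ^ 'n \<Rightarrow> real \<Rightarrow> real ^ 'n"
    and g :: "real ^ 'n \<Rightarrow> real \<Rightarrow> real ^ 'n ^ 'n"
    and M :: nat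
    and m :: "'k::finite \<Rightarrow> nat ^ 'n"
    and mb :: "'r::finite \<Rightarrow> nat ^ 'n"
    and a :: "real \<Rightarrow> real ^ 'k"
    and A :: "real \<Rightarrow> real ^ 'k ^ 'k"
    and B :: "real \<Rightarrow> real ^ 'r ^ 'k"
    and \<nu> :: "real \<Rightarrow> real ^ 'k"
    and x0 :: "real ^ 'n"
    and t0 T :: real
  assumes "prob_space P"
    and "wiener_process P F W"
    and "0 \<le> t0" and "t0 < T"
    and f_poly: "\<And>t. 0 \<le> t \<Longrightarrow> polynomial_function (\<lambda>x. f x t)"
    and g_poly: "\<And>t. 0 \<le> t \<Longrightarrow> polynomial_function (\<lambda>x. g x t)"
    and f_diff: "\<And>x. (\<lambda>t. f x t) differentiable (at t0 within {t0..<T})"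
    and g_diff: "\<And>x. (\<lambda>t. g x t) differentiable (at t0 within {t0..<T})"
    and sde: "sde_solution P F W f g t0 T x0 X"
    and evolve: "moments_evolve P f g {t0..<T} X"
    and "2 \<le> M"
    and m: "bij_betw m UNIV {q. 1 \<le> mdeg q \<and> mdeg q \<le> M}"
    and mb: "inj mb" "\<And>q. M + 1 \<le> mdeg (mb q)"
    and coeffs: "moment_dynamics_coeffs f g {t0..<T} m mb a A B"
    and closed: "closed_system_solution {t0..<T} m mb a A B \<nu>"
    and init: "moment_vec P X m t0 = \<nu> t0"
  shows "(\<exists>D. (moment_vec P X m has_vector_derivative D) (at t0 within {t0..<T}) \<and>
              (\<nu> has_vector_derivative D) (at t0 within {t0..<T})) \<and>
         (\<exists>D. ((\<lambda>t. vector_derivative (moment_vec P X m) (at t within {t0..<T}))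
                 has_vector_derivative D) (at t0 within {t0..<T}) \<and>
              ((\<lambda>t. vector_derivative \<nu> (at t within {t0..<T}))
                 has_vector_derivative D) (at t0 within {t0..<T}))"
proof -
  interpret prob_space P by fact
  interpret truncated_moments M m by unfold_locales fact+
  define S where "S = {t0..<T}"
  define L where "L t q x = generator (f x t) (g x t ** transpose (g x t)) q x" for t q x
  let ?\<mu> = "moment_vec P X m" and ?\<mu>b = "moment_vec P X mb"
  have t0: "t0 \<in> S"
    using \<open>t0 < T\<close> by (simp add: S_def)
  have S_nonneg: "0 \<le> t" if "t \<in> S" for t
    using that \<open>0 \<le> t0\<close> by (simp add: S_def)
  have X0: "AE \<omega> in P. X t0 \<omega> = x0"
    using sde by (simp add: sde_solution_def)

  have L_affine: "L t (m s) x = a t $ s + (\<Sum>p\<in>UNIV. A t $ s $ p * mpow x (m p))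
      + (\<Sum>r\<in>UNIV. B t $ s $ r * mpow x (mb r))" if "t \<in> S" for t s x
    using coeffs that
    by (simp add: moment_dynamics_coeffs_def L_def generator_def S_def mat_vec_nth)
  have L_diff: "(\<lambda>t. L t q x) differentiable (at t0 within S)" for q x
    unfolding L_def S_def by (intro differentiable_generator f_diff g_diff)
  have disj: "m p \<noteq> 0" "mb r \<noteq> 0" "m p \<noteq> mb r" for p r
    using mdeg_m[of p] mb(2)[of r] by (auto simp: mdeg_def)
  note coeffs_diff = monomial_coeffs_differentiable[OF inj_m mb(1) disj t0 L_affine L_diff]

  have int: "integrable P (\<lambda>\<omega>. mpow (X t \<omega>) q)" if "t \<in> S" for t q
    using evolve that by (simp add: moments_evolve_def S_def)
  have int_L: "integrable P (\<lambda>\<omega>. L t q (X t \<omega>))"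
    and deriv_moment: "(moment P X q has_real_derivative (\<integral>\<omega>. L t q (X t \<omega>) \<partial>P)) (at t within S)"
    if "t \<in> S" for t q
    using moments_evolve_generator[OF evolve[folded S_def] that f_poly[OF S_nonneg[OF that]]
        g_poly[OF S_nonneg[OF that]], of q]
    unfolding L_def by blast+
  have integral_L: "(\<integral>\<omega>. L t (m s) (X t \<omega>) \<partial>P) = (a t + A t *v ?\<mu> t + B t *v ?\<mu>b t) $ s"
    if "t \<in> S" for t s
    by (simp add: L_affine[OF that] int[OF that] prob_space mat_vec_nth moment_vec_def moment_def)
  have deriv_\<mu>: "(?\<mu> has_vector_derivative (a t + A t *v ?\<mu> t + B t *v ?\<mu>b t)) (at t within S)"
    if "t \<in> S" for t
    using deriv_moment[OF that]
    unfolding has_vector_derivative_vec_iff integral_L[OF that, symmetric]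
    by (simp add: moment_vec_def)

  have moment_t0: "moment P X q t0 = mpow x0 q" for q
    unfolding moment_def by (rule integral_AE_const[OF int[OF t0] X0])
  have L_t0: "(\<integral>\<omega>. L t0 q (X t0 \<omega>) \<partial>P) = L t0 q x0" for q
    by (rule integral_AE_const[OF int_L[OF t0] X0])
  have \<nu>_t0: "\<nu> t0 = (\<chi> p. mpow x0 (m p))"
    by (simp add: init[symmetric] moment_vec_def moment_t0)

  \<comment> \<open>Closure entries whose column of \<open>B\<close> vanishes on \<open>S\<close>
    may be undefined at \<open>\<nu> t\<close>. In \<open>w\<close> the true moments replace them,
    which leaves the closed system unchanged and makes \<open>w\<close> differentiable at
    \<open>t0\<close>.\<close>
  define active where "active r \<longleftrightarrow> (\<exists>u\<in>S. column r (B u) \<noteq> 0)" for r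
  define w where "w t = (\<chi> r. if active r then closure_fun m mb (\<nu> t) $ r else ?\<mu>b t $ r)" for t
  have B_inactive: "B t $ s $ r = 0" if "\<not> active r" "t \<in> S" for t s r
  proof -
    have "column r (B t) = 0" using that by (auto simp: active_def)
    then show ?thesis by (simp add: column_def vec_eq_iff)
  qed
  have "B t *v closure_fun m mb (\<nu> t) = B t *v w t" if "t \<in> S" for t
    unfolding vec_eq_iff mat_vec_nth
    by (intro allI sum.cong refl) (auto simp: w_def B_inactive[OF _ that])
  then have deriv_\<nu>: "(\<nu> has_vector_derivative (a t + A t *v \<nu> t + B t *v w t)) (at t within S)"
    if "t \<in> S" for t
    using closed that by (simp add: closed_system_solution_def S_def)
  have defined: "real_pow_defined (mpow x0 (m p)) (closure_exponents m (mb r) $ p)"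
    if "active r" for r p
  proof -
    have "real_pow_defined (\<nu> t0 $ p) (closure_exponents m (mb r) $ p)"
      using closed that t0 by (auto simp: closed_system_solution_def S_def active_def)
    then show ?thesis by (simp add: \<nu>_t0)
  qed
  have w_t0: "w t0 = ?\<mu>b t0"
    using closure_fun_mpow[where mb = mb, OF defined]
    by (simp add: w_def vec_eq_iff \<nu>_t0 moment_vec_def moment_t0)
  \<comment> \<open>Both right-hand sides agree at \<open>t0\<close>: this is the first-order claim,
    and it supplies the velocity needed to differentiate the closure along
    \<open>\<nu>\<close>.\<close>
  have deriv_\<nu>_t0: "(\<nu> has_vector_derivative (a t0 + A t0 *v ?\<mu> t0 + B t0 *v ?\<mu>b t0)) (at t0 within S)"
    using deriv_\<nu>[OF t0] by (simp add: w_t0 init)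
  then have "((\<lambda>t. \<nu> t $ p) has_real_derivative L t0 (m p) x0) (at t0 within S)" for p
    unfolding has_vector_derivative_vec_iff integral_L[OF t0, symmetric] L_t0 by blast
  note deriv_closure = has_derivative_closure_fun[where mb = mb, OF defined this[unfolded L_def] \<nu>_t0, folded L_def]
  have deriv_\<mu>b: "(?\<mu>b has_vector_derivative (\<chi> r. L t0 (mb r) x0)) (at t0 within S)"
    using deriv_moment[OF t0] by (simp add: has_vector_derivative_vec_iff moment_vec_def L_t0)
  have deriv_w: "(w has_vector_derivative (\<chi> r. L t0 (mb r) x0)) (at t0 within S)"
    unfolding has_vector_derivative_vec_iff
  proof
    fix r
    show "((\<lambda>t. w t $ r) has_real_derivative (\<chi> r. L t0 (mb r) x0) $ r) (at t0 within S)"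
      using deriv_closure[of r] deriv_\<mu>b
      by (cases "active r") (simp_all add: w_def has_vector_derivative_vec_iff)
  qed

  obtain D where D: "\<And>u v. u t0 = ?\<mu> t0 \<Longrightarrow> v t0 = ?\<mu>b t0 \<Longrightarrow>
      (u has_vector_derivative (a t0 + A t0 *v ?\<mu> t0 + B t0 *v ?\<mu>b t0)) (at t0 within S) \<Longrightarrow>
      (v has_vector_derivative (\<chi> r. L t0 (mb r) x0)) (at t0 within S) \<Longrightarrow>
      ((\<lambda>t. a t + A t *v u t + B t *v v t) has_vector_derivative D) (at t0 within S)"
    using affine_system_common_derivative[of a t0 S A B, OF coeffs_diff] by blast
  \<comment> \<open>Throughout \<open>S\<close> the derivatives of \<open>?\<mu>\<close> and
    \<open>\<nu>\<close> are thereby replaced by the right-hand sides of their systems, whose common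
    derivative at \<open>t0\<close> is \<open>D\<close>.\<close>
  have vd: "vector_derivative u (at t within S) = d"
    if "t \<in> S" "(u has_vector_derivative d) (at t within S)" for u :: "real \<Rightarrow> real ^ 'k" and t d
    using that at_within_Ico_neq_bot unfolding S_def by (intro vector_derivative_within)
  have "((\<lambda>t. vector_derivative ?\<mu> (at t within S)) has_vector_derivative D) (at t0 within S)"
    by (rule has_vector_derivative_transform[OF t0 vd[OF _ deriv_\<mu>]
          D[OF refl refl deriv_\<mu>[OF t0] deriv_\<mu>b]])
  moreover have "((\<lambda>t. vector_derivative \<nu> (at t within S)) has_vector_derivative D) (at t0 within S)"
    by (rule has_vector_derivative_transform[OF t0 vd[OF _ deriv_\<nu>]
          D[OF init[symmetric] w_t0 deriv_\<nu>_t0 deriv_w]])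
  ultimately show ?thesis
    using deriv_\<mu>[OF t0] deriv_\<nu>_t0 unfolding S_def by blast
qed

end
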